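(* Let $L\ge1$. Over all feasible stage exponents, i.e. $a_1,\dots,a_L\ge0$ with $\sum_{\ell=1}^La_\ell=1$, the smallest polynomial exponent of $\Lambda_2$ for the $L$-stage sequential hierarchy with stage ratios $r_\ell=k^{a_\ell}$ is $$1+(1-2^{-L})^{-1},$$ and it is attained by $$a_\ell=\frac{2^{-\ell}}{1-2^{-L}},\qquad \ell=1,\dots,L.$$ The corresponding RMS exponent is $$\alpha_\mu(L)=\frac{2^{L+1}-1}{2^{L+1}-2}.$$
   Context: For a full binary tree $T$, $\Lambda_2(T)=\sum_{v}|\mathcal L(v)|^2$, the sum over internal nodes $v$ of the square of the number of leaves below $v$. An $L$-stage sequential hierarchy on $k$ leaves has stage ratios $r_1,\dots,r_L$ with $\prod_{\ell=1}^Lr_\ell=k$ and cumulative sizes $s_\ell=\prod_{j\le\ell}r_j$: at stage $\ell$, each group of $r_\ell$ consecutive totals of blocks of size $s_{\ell-1}$ (with $s_0=1$) is summed sequentially to give the total of a block of size $s_\ell$. At leading order $\Lambda_2\sim\frac k3\sum_{\ell=1}^Ls_\ell r_\ell$. With $r_\ell=k^{a_\ell}$, $A_0=0$ and $A_\ell=\sum_{j=1}^\ell a_j$, the $\ell$th term $ks_\ell r_\ell$ equals $k^{E_\ell}$ with $E_\ell=1+A_{\ell-1}+2a_\ell$. The polynomial exponent of $\Lambda_2$ for stage exponents $(a_1,\dots,a_L)$ is $\max_{1\le\ell\le L}E_\ell$, the exponent of $k$ in the growth of this leading-order expression. The RMS exponent is half of the polynomial exponent of $\Lambda_2$. *)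

theory Defs
  imports Complex_Main "HOL-Library.Tree" "HOL-Library.Landau_Symbols"
begin

text \<open>A full binary tree is an element of \<^typ>\<open>unit tree\<close>: every \<^const>\<open>Node\<close> is an internal
  node with exactly two children, and \<^const>\<open>size1\<close> counts the leaves.\<close>

fun Lambda2 :: "unit tree \<Rightarrow> nat" where
  "Lambda2 Leaf = 0"
| "Lambda2 (Node l u r) = size1 (Node l u r) ^ 2 + Lambda2 l + Lambda2 r"

text \<open>The tree summing \<open>n + 1\<close> consecutive totals sequentially, each total being computed by
  a copy of \<open>t\<close>.\<close>

fun sequential_sum :: "unit tree \<Rightarrow> nat \<Rightarrow> unit tree" where
  "sequential_sum t 0 = t"
| "sequential_sum t (Suc n) = Node (sequential_sum t n) () t"

text \<open>Stages are numbered from 1; \<open>r l\<close> (assumed positive) is the ratio of stage \<open>l\<close>.\<close>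

fun hierarchy :: "(nat \<Rightarrow> nat) \<Rightarrow> nat \<Rightarrow> unit tree" where
  "hierarchy r 0 = Leaf"
| "hierarchy r (Suc l) = sequential_sum (hierarchy r l) (r (Suc l) - 1)"

definition cumulative_size :: "(nat \<Rightarrow> 'a::comm_semiring_1) \<Rightarrow> nat \<Rightarrow> 'a" where
  "cumulative_size r l = (\<Prod>j=1..l. r j)"

definition leading_Lambda2 :: "nat \<Rightarrow> (nat \<Rightarrow> real) \<Rightarrow> real" where
  "leading_Lambda2 L r =
     cumulative_size r L / 3 * (\<Sum>l=1..L. cumulative_size r l * r l)"

text \<open>Stage exponents are functions \<open>a\<close> on the naturals of which only \<open>a 1, \<dots>, a L\<close> matter.\<close>

definition feasible :: "nat \<Rightarrow> (nat \<Rightarrow> real) \<Rightarrow> bool" where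
  "feasible L a \<longleftrightarrow> (\<forall>l\<in>{1..L}. 0 \<le> a l) \<and> (\<Sum>l=1..L. a l) = 1"

definition stage_ratio :: "real \<Rightarrow> (nat \<Rightarrow> real) \<Rightarrow> nat \<Rightarrow> real" where
  "stage_ratio k a l = k powr a l"

definition cumulative_exponent :: "(nat \<Rightarrow> real) \<Rightarrow> nat \<Rightarrow> real" where
  "cumulative_exponent a l = (\<Sum>j=1..l. a j)"

definition stage_exponent :: "(nat \<Rightarrow> real) \<Rightarrow> nat \<Rightarrow> real" where
  "stage_exponent a l = 1 + cumulative_exponent a (l - 1) + 2 * a l"

definition polynomial_exponent :: "nat \<Rightarrow> (nat \<Rightarrow> real) \<Rightarrow> real" where
  "polynomial_exponent L a = Max (stage_exponent a ` {1..L})"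

definition rms_exponent :: "nat \<Rightarrow> (nat \<Rightarrow> real) \<Rightarrow> real" where
  "rms_exponent L a = polynomial_exponent L a / 2"

text \<open>The remaining facts relate these exponents to \<^const>\<open>Lambda2\<close> of the actual trees.\<close>

lemma size1_sequential_sum: "size1 (sequential_sum t n) = Suc n * size1 t"
  by (induction n) auto

lemma size1_hierarchy:
  assumes "\<And>l. r l > 0"
  shows "size1 (hierarchy r l) = cumulative_size r l"
  using assms by (induction l) (auto simp: size1_sequential_sum cumulative_size_def mult.commute)

lemma Lambda2_sequential_sum:
  "6 * real (Lambda2 (sequential_sum t n)) =
     6 * real (Suc n) * real (Lambda2 t) +
     real (size1 t) ^ 2 * (2 * real (Suc n) ^ 3 + 3 * real (Suc n) ^ 2 + real (Suc n) - 6)"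
proof (induction n)
  case (Suc n)
  have "size1 (sequential_sum t (Suc n)) = Suc (Suc n) * size1 t"
    by (rule size1_sequential_sum)
  then have "6 * real (Lambda2 (sequential_sum t (Suc n))) =
     6 * (real (Suc (Suc n)) * real (size1 t)) ^ 2
     + 6 * real (Lambda2 (sequential_sum t n)) + 6 * real (Lambda2 t)"
    by (simp add: algebra_simps)
  with Suc show ?case
    by (simp add: algebra_simps power2_eq_square power3_eq_cube)
qed simp

lemma Lambda2_hierarchy_leading_order:
  fixes r :: "nat \<Rightarrow> nat"
  assumes pos: "\<And>l. r l > 0"
  shows "\<bar>real (Lambda2 (hierarchy r L)) - leading_Lambda2 L (\<lambda>l. real (r l))\<bar>
           \<le> real (cumulative_size r L) * (\<Sum>l=1..L. real (cumulative_size r l))"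
proof (induction L)
  case 0
  then show ?case by (simp add: leading_Lambda2_def)
next
  case (Suc L)
  define x where "x = real (r (Suc L))"
  define s where "s = real (cumulative_size r L)"
  define Lam where "Lam = real (Lambda2 (hierarchy r L))"
  define S where "S = (\<Sum>l=1..L. cumulative_size (\<lambda>l. real (r l)) l * real (r l))"
  define T where "T = (\<Sum>l=1..L. real (cumulative_size r l))"
  have x: "x \<ge> 1" using pos[of "Suc L"] by (simp add: x_def)
  have s: "s \<ge> 0" by (simp add: s_def)
  have cs: "cumulative_size (\<lambda>l. real (r l)) l = real (cumulative_size r l)" for l
    by (simp add: cumulative_size_def)
  have cS: "real (cumulative_size r (Suc L)) = s * x"
    by (simp add: cumulative_size_def s_def x_def mult.commute)
  have IH: "\<bar>Lam - s / 3 * S\<bar> \<le> s * T"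
    using Suc by (simp add: Lam_def leading_Lambda2_def S_def T_def s_def cs)
  have "real (Suc (r (Suc L) - 1)) = x"
    using pos[of "Suc L"] by (simp add: x_def)
  then have "6 * real (Lambda2 (hierarchy r (Suc L)))
      = 6 * x * Lam + s ^ 2 * (2 * x ^ 3 + 3 * x ^ 2 + x - 6)"
    using Lambda2_sequential_sum[of "hierarchy r L" "r (Suc L) - 1"]
    by (simp add: size1_hierarchy[OF pos] Lam_def s_def)
  then have lam: "real (Lambda2 (hierarchy r (Suc L)))
      = x * Lam + s ^ 2 * (2 * x ^ 3 + 3 * x ^ 2 + x - 6) / 6"
    by simp
  have lead: "leading_Lambda2 (Suc L) (\<lambda>l. real (r l)) = s * x / 3 * (S + s * x * x)"
    by (simp add: leading_Lambda2_def cs cS S_def flip: x_def)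
  have tot: "(\<Sum>l=1..Suc L. real (cumulative_size r l)) = T + s * x"
    by (simp add: T_def cS)
  have "x * 1 \<le> x * x" using x by (intro mult_left_mono) auto
  then have xx: "x \<le> x ^ 2" "1 \<le> x ^ 2" using x by (auto simp: power2_eq_square intro: order_trans)
  have "\<bar>(3 * x ^ 2 + x - 6) / 6\<bar> \<le> x ^ 2"
    using x xx by (simp add: abs_le_iff)
  then have e: "\<bar>s ^ 2 * ((3 * x ^ 2 + x - 6) / 6)\<bar> \<le> s ^ 2 * x ^ 2"
    by (simp only: abs_mult abs_power2) (intro mult_left_mono, auto)
  have "real (Lambda2 (hierarchy r (Suc L))) - leading_Lambda2 (Suc L) (\<lambda>l. real (r l))
     = x * (Lam - s / 3 * S) + s ^ 2 * ((3 * x ^ 2 + x - 6) / 6)"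
    unfolding lam lead by (simp add: field_simps power2_eq_square power3_eq_cube)
  also have "\<bar>\<dots>\<bar> \<le> x * (s * T) + s ^ 2 * x ^ 2"
  proof -
    have "\<bar>x * (Lam - s / 3 * S)\<bar> \<le> x * (s * T)"
      using IH x by (simp only: abs_mult) (intro mult_mono, auto)
    then show ?thesis using e by linarith
  qed
  also have "\<dots> = s * x * (T + s * x)"
    by (simp add: algebra_simps power2_eq_square)
  finally show ?case unfolding cS tot .
qed

lemma stage_term_eq:
  assumes "k > 0" "l \<ge> 1"
  shows "k * cumulative_size (stage_ratio k a) l * stage_ratio k a l = k powr stage_exponent a l"
proof -
  have A: "cumulative_size (stage_ratio k a) m = k powr cumulative_exponent a m" for m
    using assms by (simp add: cumulative_size_def stage_ratio_def cumulative_exponent_def powr_sum)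
  obtain m where l: "l = Suc m" using assms by (cases l) auto
  have "stage_exponent a l = 1 + cumulative_exponent a l + a l"
    by (simp add: stage_exponent_def cumulative_exponent_def l)
  then show ?thesis using assms by (simp add: A stage_ratio_def powr_add)
qed

lemma leading_Lambda2_stage_ratio:
  assumes "feasible L a" "k > 0"
  shows "leading_Lambda2 L (stage_ratio k a) = (\<Sum>l=1..L. k powr stage_exponent a l) / 3"
proof -
  have "cumulative_size (stage_ratio k a) L = k"
    using assms by (simp add: cumulative_size_def stage_ratio_def feasible_def flip: powr_sum)
  then have "leading_Lambda2 L (stage_ratio k a) =
      (\<Sum>l=1..L. k * cumulative_size (stage_ratio k a) l * stage_ratio k a l) / 3"
    unfolding leading_Lambda2_def by (simp add: sum_distrib_left sum_divide_distrib mult.assoc)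
  also have "(\<Sum>l=1..L. k * cumulative_size (stage_ratio k a) l * stage_ratio k a l)
      = (\<Sum>l=1..L. k powr stage_exponent a l)"
    by (rule sum.cong[OF refl], rule stage_term_eq) (use assms in auto)
  finally show ?thesis .
qed

lemma leading_Lambda2_growth:
  assumes L: "L \<ge> 1" and a: "feasible L a"
  shows "(\<lambda>k. leading_Lambda2 L (stage_ratio k a)) \<in> \<Theta>(\<lambda>k. k powr polynomial_exponent L a)"
proof -
  let ?M = "polynomial_exponent L a"
  have M: "?M \<in> stage_exponent a ` {1..L}"
    unfolding polynomial_exponent_def using L by (intro Max_in) auto
  then obtain m where m: "m \<in> {1..L}" "?M = stage_exponent a m" by auto
  have le: "stage_exponent a l \<le> ?M" if "l \<in> {1..L}" for l
    unfolding polynomial_exponent_def using that by (intro Max_ge) auto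
  have b: "k powr ?M / 3 \<le> leading_Lambda2 L (stage_ratio k a)"
          "leading_Lambda2 L (stage_ratio k a) \<le> real L / 3 * k powr ?M" if "k \<ge> 1" for k
  proof -
    have "k powr stage_exponent a m \<le> (\<Sum>l=1..L. k powr stage_exponent a l)"
      by (rule member_le_sum[OF m(1)]) auto
    moreover have "(\<Sum>l=1..L. k powr stage_exponent a l) \<le> (\<Sum>l=1..L. k powr ?M)"
      by (intro sum_mono powr_mono le that)
    ultimately show "k powr ?M / 3 \<le> leading_Lambda2 L (stage_ratio k a)"
          "leading_Lambda2 L (stage_ratio k a) \<le> real L / 3 * k powr ?M"
      using that a m by (auto simp: leading_Lambda2_stage_ratio)
  qed
  show ?thesis
  proof (rule bigthetaI')
    show "\<forall>\<^sub>F k in at_top. 1 / 3 * norm (k powr ?M) \<le> norm (leading_Lambda2 L (stage_ratio k a))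
        \<and> norm (leading_Lambda2 L (stage_ratio k a)) \<le> real L / 3 * norm (k powr ?M)"
      using eventually_ge_at_top[of "1::real"]
    proof eventually_elim
      case (elim k)
      have "0 \<le> leading_Lambda2 L (stage_ratio k a)"
        by (rule order_trans[OF _ b(1)[OF elim]]) simp
      then show ?case using b[OF elim] by simp
    qed
  qed (use L in auto)
qed

end

theory Submission
  imports Defs
begin

text \<open>Writing \<open>A\<^sub>l\<close> for the cumulative exponents, the stage exponents are
  \<open>E\<^sub>l = 1 + 2 A\<^sub>l - A\<^bsub>l-1\<^esub>\<close>. If all of them are at most \<open>1 + c\<close>, then
  \<open>A\<^sub>l \<le> (c + A\<^bsub>l-1\<^esub>) / 2\<close>, and iterating from \<open>A\<^sub>0 = 0\<close> gives \<open>A\<^sub>l \<le> c (1 - 2\<^sup>-\<^sup>l)\<close>.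
  Feasibility means \<open>A\<^sub>L = 1\<close>, so \<open>c \<ge> 1 / (1 - 2\<^sup>-\<^sup>L)\<close>; equalising all \<open>E\<^sub>l\<close> attains the bound.\<close>

lemma stage_exponent_Suc:
  "stage_exponent a (Suc l) = 1 + 2 * cumulative_exponent a (Suc l) - cumulative_exponent a l"
  by (simp add: stage_exponent_def cumulative_exponent_def)

lemma cumulative_exponent_le:
  assumes "\<And>j. j \<in> {1..l} \<Longrightarrow> stage_exponent a j \<le> 1 + c"
  shows "cumulative_exponent a l \<le> c * (1 - (1 / 2) ^ l)"
  using assms
proof (induction l)
  case 0
  then show ?case by (simp add: cumulative_exponent_def)
next
  case (Suc l)
  have "cumulative_exponent a l \<le> c * (1 - (1 / 2) ^ l)"
    using Suc by simp
  moreover have "stage_exponent a (Suc l) \<le> 1 + c"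
    using Suc.prems by simp
  ultimately have "2 * cumulative_exponent a (Suc l) \<le> c + c * (1 - (1 / 2) ^ l)"
    by (simp add: stage_exponent_Suc)
  \<comment> \<open>Halving the right-hand side \<open>c * (2 - (1 / 2) ^ l)\<close> gives exactly
    the bound for \<open>Suc l\<close>.\<close>
  then show ?case by (simp add: algebra_simps)
qed

lemma polynomial_exponent_ge:
  assumes L: "L \<ge> 1" and a: "feasible L a"
  shows "1 + inverse (1 - (1 / 2) ^ L) \<le> polynomial_exponent L a"
proof -
  define c where "c = polynomial_exponent L a - 1"
  have "stage_exponent a j \<le> 1 + c" if "j \<in> {1..L}" for j
    unfolding c_def polynomial_exponent_def using that by simp
  then have "cumulative_exponent a L \<le> c * (1 - (1 / 2) ^ L)"
    by (rule cumulative_exponent_le)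
  moreover have "cumulative_exponent a L = 1"
    using a by (simp add: feasible_def cumulative_exponent_def)
  \<comment> \<open>Positivity allows dividing \<open>1 \<le> c * (1 - (1 / 2) ^ L)\<close> by the
    factor of \<open>c\<close>.\<close>
  moreover have "1 - (1 / 2) ^ L > (0 :: real)"
    using L by (simp add: power_less_one_iff)
  ultimately have "inverse (1 - (1 / 2) ^ L) \<le> c"
    by (simp add: inverse_eq_divide pos_divide_le_eq)
  then show ?thesis by (simp add: c_def)
qed

text \<open>A finite geometric sum; it meets the bound of \<open>cumulative_exponent_le\<close> with
  equality.\<close>

lemma cumulative_exponent_geometric:
  assumes "\<And>j. j \<in> {1..l} \<Longrightarrow> a j = c * (1 / 2) ^ j"
  shows "cumulative_exponent a l = c * (1 - (1 / 2) ^ l)"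
  using assms
proof (induction l)
  case (Suc l)
  then have "cumulative_exponent a l = c * (1 - (1 / 2) ^ l)"
    by simp
  then show ?case
    using Suc.prems[of "Suc l"] by (simp add: cumulative_exponent_def algebra_simps)
qed (simp add: cumulative_exponent_def)

text \<open>In \<open>2 * A l - A (l - 1)\<close> the powers of \<open>1 / 2\<close> cancel, so all
  stages have the same exponent.\<close>

lemma polynomial_exponent_geometric:
  assumes L: "L \<ge> 1" and a: "\<And>l. l \<in> {1..L} \<Longrightarrow> a l = c * (1 / 2) ^ l"
  shows "polynomial_exponent L a = 1 + c"
proof -
  have "stage_exponent a l = 1 + c" if l: "l \<in> {1..L}" for l
  proof -
    obtain m where m: "l = Suc m" using l by (cases l) auto
    have A: "cumulative_exponent a i = c * (1 - (1 / 2) ^ i)" if "i \<le> l" for i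
      by (rule cumulative_exponent_geometric) (use a l that in auto)
    show ?thesis
      using A[of "Suc m"] A[of m] by (simp add: m stage_exponent_Suc algebra_simps)
  qed
  then have "stage_exponent a ` {1..L} = {1 + c}"
    using L by force
  then show ?thesis by (simp add: polynomial_exponent_def)
qed

theorem proposition3p4:
  fixes L :: nat and opt :: "nat \<Rightarrow> real"
  assumes "L \<ge> 1"
    and "\<And>l. l \<in> {1..L} \<Longrightarrow> opt l = 2 powr (- real l) / (1 - 2 powr (- real L))"
  shows "is_arg_min (polynomial_exponent L) (feasible L) opt
    \<and> polynomial_exponent L opt = 1 + inverse (1 - 2 powr (- real L))
    \<and> rms_exponent L opt = (2 ^ (L + 1) - 1) / (2 ^ (L + 1) - 2)"
proof -
  have powr: "2 powr (- real l) = (1 / 2) ^ l" for l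
    by (simp add: powr_minus powr_realpow power_one_over inverse_eq_divide)
  \<comment> \<open>This factor normalises the geometric exponents to total 1 and is also the lower
    bound for the excess over 1.\<close>
  define c :: real where "c = inverse (1 - (1 / 2) ^ L)"
  have pos: "1 - (1 / 2) ^ L > (0 :: real)"
    using assms(1) by (simp add: power_less_one_iff)
  have opt: "opt l = c * (1 / 2) ^ l" if "l \<in> {1..L}" for l
    using assms(2)[OF that] by (simp add: powr c_def inverse_eq_divide)
  have poly_opt: "polynomial_exponent L opt = 1 + c"
    using assms(1) opt by (rule polynomial_exponent_geometric)
  have "cumulative_exponent opt L = 1"
    using cumulative_exponent_geometric[of L opt c] opt pos by (simp add: c_def)
  then have "feasible L opt"
    using opt pos by (auto simp: feasible_def cumulative_exponent_def c_def)
  then have "is_arg_min (polynomial_exponent L) (feasible L) opt"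
    using polynomial_exponent_ge[OF assms(1)]
    by (auto simp: is_arg_min_linorder poly_opt c_def)
  moreover have "rms_exponent L opt = (2 ^ (L + 1) - 1) / (2 ^ (L + 1) - 2)"
  proof -
    \<comment> \<open>Clearing denominators in \<open>(1 + c) / 2\<close> with
      \<open>c = 2 ^ L / (2 ^ L - 1)\<close> needs \<open>2 ^ L \<noteq> 1\<close>.\<close>
    have "(2 :: real) ^ L > 1" using assms(1) by simp
    then show ?thesis
      by (simp add: rms_exponent_def poly_opt c_def field_simps)
  qed
  ultimately show ?thesis by (simp add: poly_opt powr c_def)
qed

end
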